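(* There is no distance-regular graph with intersection array $\{135,128,16;1,16,120\}$.
   Context: A connected graph $\Gamma$ of diameter $d$ is distance-regular if there are constants $p^h_{ij}$ ($0\le h,i,j\le d$) such that for any two vertices $u,v$ at distance $h$, the number of vertices at distance $i$ from $u$ and distance $j$ from $v$ is $p^h_{ij}$. Its intersection array is $\{b_0,b_1,\dots,b_{d-1};c_1,c_2,\dots,c_d\}$ where $b_i=p^i_{1,i+1}$ and $c_{i+1}=p^{i+1}_{1,i}$. *)

theory Defs
  imports "Graph_Theory.Graph_Theory"
begin

text \<open>
  A simple undirected graph is a symmetric loop-free arc relation:
  \<^locale>\<open>pair_bidirected_digraph\<close>. Finiteness of the vertex set is not assumed; instead,
  the intersection numbers are required to count finite sets.
\<close>

text \<open>Only meaningful if some walk leads from \<open>u\<close> to \<open>v\<close>, as in a connected graph.\<close>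

definition graph_dist :: "'a pair_pre_digraph \<Rightarrow> 'a \<Rightarrow> 'a \<Rightarrow> nat" where
  "graph_dist G u v = (LEAST n. \<exists>p. pre_digraph.awalk (with_proj G) u p v \<and> length p = n)"

definition has_diameter :: "'a pair_pre_digraph \<Rightarrow> nat \<Rightarrow> bool" where
  "has_diameter G d \<longleftrightarrow>
     (\<forall>u\<in>pverts G. \<forall>v\<in>pverts G. graph_dist G u v \<le> d) \<and>
     (\<exists>u\<in>pverts G. \<exists>v\<in>pverts G. graph_dist G u v = d)"

text \<open>\<open>p h i j\<close> is the intersection number $p^h_{ij}$.\<close>

definition has_intersection_numbers ::
    "'a pair_pre_digraph \<Rightarrow> nat \<Rightarrow> (nat \<Rightarrow> nat \<Rightarrow> nat \<Rightarrow> nat) \<Rightarrow> bool" where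
  "has_intersection_numbers G d p \<longleftrightarrow>
     (\<forall>h\<le>d. \<forall>i\<le>d. \<forall>j\<le>d. \<forall>u\<in>pverts G. \<forall>v\<in>pverts G. graph_dist G u v = h \<longrightarrow>
        finite {w \<in> pverts G. graph_dist G u w = i \<and> graph_dist G v w = j} \<and>
        card {w \<in> pverts G. graph_dist G u w = i \<and> graph_dist G v w = j} = p h i j)"

definition distance_regular :: "'a pair_pre_digraph \<Rightarrow> bool" where
  "distance_regular G \<longleftrightarrow>
     pair_bidirected_digraph G \<and> Digraph_Component.connected (with_proj G) \<and>
     (\<exists>d p. has_diameter G d \<and> has_intersection_numbers G d p)"

text \<open>
  The array $\{b_0,\dots,b_{d-1};c_1,\dots,c_d\}$ is given by the lists
  \<open>bs = [b\<^sub>0, \<dots>, b\<^sub>d\<^sub>-\<^sub>1]\<close> and \<open>cs = [c\<^sub>1, \<dots>, c\<^sub>d]\<close>, so \<open>cs ! i\<close> is $c_{i+1}$.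
\<close>

definition has_intersection_array ::
    "'a pair_pre_digraph \<Rightarrow> nat list \<Rightarrow> nat list \<Rightarrow> bool" where
  "has_intersection_array G bs cs \<longleftrightarrow>
     (\<exists>d p. has_diameter G d \<and> has_intersection_numbers G d p \<and>
        length bs = d \<and> length cs = d \<and>
        (\<forall>i<d. bs ! i = p i 1 (i + 1) \<and> cs ! i = p (i + 1) 1 i))"

end

theory Submission
  imports Defs
begin

text \<open>
  The array forces the eigenvalue $-25$, whose primitive idempotent is, up to a scalar, the kernel
  $K(x,y) = \varphi(d(x,y))$ with $\varphi = (27,-5,1,-3)$. It satisfies $K^2 = 240 K$ and
  $\sum_{x,y} K(x,y)^3 = 0$, that is, the Krein parameter $q^3_{33}$ vanishes. Expanding the square,
  $\sum_{u,v,w} (\sum_x K(u,x) K(v,x) K(w,x))^2 = 240^3 \sum_{x,y} K(x,y)^3 = 0$,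
  so the inner sum is zero for all $u,v,w$. Since $a_1 = 6$, there is a triangle $u,v,w$. If
  $\alpha$ and $\beta$ count the vertices at distance 1, respectively 3, from all three, then all
  other triple intersection numbers are determined by $\alpha$ and $\beta$, and the vanishing of the
  inner sum becomes $27\alpha + 8\beta = 71$, which has no solution in natural numbers.
\<close>

section \<open>The graph metric\<close>

context pair_wf_digraph
begin

lemma graph_dist_le_length: "awalk u q v \<Longrightarrow> graph_dist G u v \<le> length q"
  unfolding graph_dist_def by (rule Least_le) blast

lemma shortest_awalk:
  assumes "u \<rightarrow>\<^sup>*\<^bsub>with_proj G\<^esub> v"
  obtains q where "awalk u q v" "length q = graph_dist G u v"
proof -
  from assms obtain q where "awalk u q v"
    by (auto simp: reachable_awalk)
  then have "\<exists>n. \<exists>q. awalk u q v \<and> length q = n"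
    by blast
  then have "\<exists>q. awalk u q v \<and> length q = graph_dist G u v"
    unfolding graph_dist_def by (rule LeastI_ex)
  then show thesis using that by blast
qed

lemma graph_dist_eq_0_iff:
  assumes "u \<in> pverts G" "u \<rightarrow>\<^sup>*\<^bsub>with_proj G\<^esub> v"
  shows "graph_dist G u v = 0 \<longleftrightarrow> u = v"
proof
  assume "graph_dist G u v = 0"
  with shortest_awalk[OF assms(2)] obtain q where "awalk u q v" "length q = 0" by metis
  then show "u = v" by (simp add: awalk_Nil_iff)
next
  assume "u = v"
  then have "awalk u [] v" using assms(1) by (simp add: awalk_Nil_iff)
  from graph_dist_le_length[OF this] show "graph_dist G u v = 0" by simp
qed

lemma graph_dist_triangle:
  assumes "u \<rightarrow>\<^sup>*\<^bsub>with_proj G\<^esub> v" "v \<rightarrow>\<^sup>*\<^bsub>with_proj G\<^esub> w"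
  shows "graph_dist G u w \<le> graph_dist G u v + graph_dist G v w"
proof -
  from shortest_awalk[OF assms(1)] obtain q where q: "awalk u q v" "length q = graph_dist G u v" .
  from shortest_awalk[OF assms(2)] obtain r where r: "awalk v r w" "length r = graph_dist G v w" .
  from graph_dist_le_length[OF awalk_appendI[OF q(1) r(1)]] show ?thesis
    using q r by simp
qed

end

lemma length_rev_path: "length (rev_path q) = length q"
  by (induction q) auto

lemma (in pair_sym_digraph) graph_dist_commute: "graph_dist G u v = graph_dist G v u"
proof -
  have "(\<exists>q. awalk u q v \<and> length q = n) \<longleftrightarrow> (\<exists>q. awalk v q u \<and> length q = n)" for n
    by (metis awalk_rev_path length_rev_path rev_path_rev_path)
  then show ?thesis by (simp add: graph_dist_def)
qed

section \<open>Triple products of a kernel\<close>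

text \<open>Expanding the squared triple products and summing over the triples first leaves the
  cubed entries of the Gram matrix of \<open>K\<close>, which \<open>conv\<close> identifies as
  \<open>c * K x y\<close>. A vanishing sum of integer squares vanishes termwise.\<close>

lemma triple_kernel_sum_eq_0:
  fixes K :: "'a \<Rightarrow> 'a \<Rightarrow> int"
  assumes fin: "finite V"
    and conv: "\<And>x y. x \<in> V \<Longrightarrow> y \<in> V \<Longrightarrow> (\<Sum>u\<in>V. K u x * K u y) = c * K x y"
    and cubes: "(\<Sum>x\<in>V. \<Sum>y\<in>V. K x y ^ 3) = 0"
    and uvw: "u \<in> V" "v \<in> V" "w \<in> V"
  shows "(\<Sum>x\<in>V. K u x * K v x * K w x) = 0"
proof -
  define T where "T a = (\<Sum>x\<in>V. K (fst a) x * K (fst (snd a)) x * K (snd (snd a)) x)" for a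
  let ?V3 = "V \<times> V \<times> V"
  \<comment> \<open>One factor per coordinate: the sum over triples splits into three equal
    sums.\<close>
  have cube: "(\<Sum>a\<in>?V3. f (fst a) * (f (fst (snd a)) * f (snd (snd a)))) = (\<Sum>u\<in>V. f u) ^ 3"
    for f :: "'a \<Rightarrow> int"
    by (simp add: sum.cartesian_product' sum_distrib_left[symmetric] sum_distrib_right[symmetric]
        power3_eq_cube mult.assoc)
  have "(\<Sum>a\<in>?V3. (T a)\<^sup>2) =
      (\<Sum>a\<in>?V3. \<Sum>x\<in>V. \<Sum>y\<in>V. (K (fst a) x * K (fst a) y) *
        ((K (fst (snd a)) x * K (fst (snd a)) y) * (K (snd (snd a)) x * K (snd (snd a)) y)))"
    by (simp add: T_def power2_eq_square sum_product mult_ac)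
  also have "\<dots> = (\<Sum>x\<in>V. \<Sum>y\<in>V. \<Sum>a\<in>?V3. (K (fst a) x * K (fst a) y) *
        ((K (fst (snd a)) x * K (fst (snd a)) y) * (K (snd (snd a)) x * K (snd (snd a)) y)))"
    by (subst sum.swap, rule sum.cong[OF refl], rule sum.swap)
  also have "\<dots> = (\<Sum>x\<in>V. \<Sum>y\<in>V. (\<Sum>u\<in>V. K u x * K u y) ^ 3)"
    by (intro sum.cong refl) (rule cube[of "\<lambda>u. K u _ * K u _"])
  also have "\<dots> = (\<Sum>x\<in>V. \<Sum>y\<in>V. c ^ 3 * K x y ^ 3)"
    by (simp add: conv power_mult_distrib)
  also have "\<dots> = 0"
    by (simp add: cubes sum_distrib_left[symmetric])
  finally have "\<forall>a\<in>?V3. (T a)\<^sup>2 = 0"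
    using fin by (subst (asm) sum_nonneg_eq_0_iff) auto
  then have "T (u, v, w) = 0"
    using uvw by simp
  then show ?thesis by (simp add: T_def)
qed

section \<open>Counting vertices by their distances\<close>

lemma sum_by_value:
  fixes F :: "'b \<Rightarrow> int"
  assumes "finite V" "finite T" "a ` V \<subseteq> T"
  shows "(\<Sum>x\<in>V. F (a x)) = (\<Sum>i\<in>T. F i * int (card {x \<in> V. a x = i}))"
proof -
  have "(\<Sum>x\<in>V. F (a x)) = (\<Sum>i\<in>T. \<Sum>x\<in>{x \<in> V. a x = i}. F (a x))"
    by (rule sum.group[OF assms, symmetric])
  also have "\<dots> = (\<Sum>i\<in>T. F i * int (card {x \<in> V. a x = i}))"
    by (intro sum.cong) simp_all
  finally show ?thesis .
qed

lemma sum_atMost_3: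
  fixes f :: "nat \<Rightarrow> 'b::comm_monoid_add"
  shows "(\<Sum>i\<le>3. f i) = f 0 + f 1 + f 2 + f 3"
  by (simp add: numeral_eq_Suc)

text \<open>A metric with values up to 3 replaces the graph: adjacency is \<open>D u v = 1\<close>,
  and the array is recorded as values of \<open>p\<close>.\<close>

locale drg_135 =
  fixes V :: "'a set" and D :: "'a \<Rightarrow> 'a \<Rightarrow> nat" and p :: "nat \<Rightarrow> nat \<Rightarrow> nat \<Rightarrow> nat"
  assumes fin: "finite V"
    and D_commute: "D u v = D v u"
    and D_eq_0: "u \<in> V \<Longrightarrow> v \<in> V \<Longrightarrow> D u v = 0 \<longleftrightarrow> u = v"
    and D_triangle: "u \<in> V \<Longrightarrow> v \<in> V \<Longrightarrow> w \<in> V \<Longrightarrow> D u w \<le> D u v + D v w"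
    and D_le: "u \<in> V \<Longrightarrow> v \<in> V \<Longrightarrow> D u v \<le> 3"
    and D_3: "\<exists>u\<in>V. \<exists>v\<in>V. D u v = 3"
    and card_p: "u \<in> V \<Longrightarrow> v \<in> V \<Longrightarrow> i \<le> 3 \<Longrightarrow> j \<le> 3 \<Longrightarrow>
      card {x \<in> V. D u x = i \<and> D v x = j} = p (D u v) i j"
    and b0: "p 0 1 1 = 135" and b1: "p 1 1 2 = 128" and b2: "p 2 1 3 = 16"
    and c1: "p 1 1 0 = 1" and c2: "p 2 1 1 = 16" and c3: "p 3 1 2 = 120"
begin

text \<open>Distance-regularity in summed form: such sums depend on \<open>u\<close> and
  \<open>v\<close> only through \<open>D u v\<close>.\<close>

lemma sum_pair:
  fixes F :: "nat \<Rightarrow> nat \<Rightarrow> int"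
  assumes "u \<in> V" "v \<in> V"
  shows "(\<Sum>x\<in>V. F (D u x) (D v x)) = (\<Sum>i\<le>3. \<Sum>j\<le>3. F i j * int (p (D u v) i j))"
proof -
  have "(\<Sum>x\<in>V. F (D u x) (D v x)) = (\<Sum>a\<in>{..3} \<times> {..3}.
      case_prod F a * int (card {x \<in> V. (D u x, D v x) = a}))"
    using sum_by_value[of V "{..3} \<times> {..3}" "\<lambda>x. (D u x, D v x)" "case_prod F"] fin D_le assms
    by (simp add: image_subset_iff)
  also have "\<dots> = (\<Sum>i\<le>3. \<Sum>j\<le>3. F i j * int (card {x \<in> V. D u x = i \<and> D v x = j}))"
    by (simp add: sum.cartesian_product')
  finally show ?thesis using assms by (simp add: card_p)
qed

lemma ex_common:
  assumes "u \<in> V" "v \<in> V" "i \<le> 3" "j \<le> 3" "p (D u v) i j \<noteq> 0"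
  obtains x where "x \<in> V" "D u x = i" "D v x = j"
proof -
  have "{x \<in> V. D u x = i \<and> D v x = j} \<noteq> {}"
    using card_p[of u v i j] assms by force
  then show thesis using that by blast
qed

text \<open>A value \<open>p h i j\<close> is tied to a count only if some pair is at distance
  \<open>h\<close>. Starting from a pair at distance 3, nonzero \<open>c3\<close> and
  \<open>c2\<close> allow steps towards one end.\<close>

lemma ex_dist:
  assumes "h \<le> 3"
  obtains u v where "u \<in> V" "v \<in> V" "D u v = h"
proof -
  obtain u3 v3 where 3: "u3 \<in> V" "v3 \<in> V" "D u3 v3 = 3" using D_3 by blast
  obtain x2 where 2: "x2 \<in> V" "D v3 x2 = 2" using ex_common[of u3 v3 1 2] 3 c3 by auto
  obtain x1 where 1: "x1 \<in> V" "D x2 x1 = 1" using ex_common[of v3 x2 1 1] 3 2 c2 by auto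
  have "D u3 u3 = 0" using 3 D_eq_0 by simp
  moreover consider "h = 0" | "h = 1" | "h = 2" | "h = 3" using assms by linarith
  ultimately show thesis using that 1 2 3 by metis
qed

section \<open>Intersection numbers forced by the array\<close>

lemma p_commute:
  assumes "h \<le> 3" "i \<le> 3" "j \<le> 3"
  shows "p h i j = p h j i"
proof -
  obtain u v where uv: "u \<in> V" "v \<in> V" "D u v = h" using ex_dist[OF assms(1)] .
  have "{x \<in> V. D u x = i \<and> D v x = j} = {x \<in> V. D v x = j \<and> D u x = i}" by blast
  then show ?thesis
    using card_p[of u v i j] card_p[of v u j i] D_commute[of u v] uv assms by simp
qed

lemma p_eq_0:
  assumes "h \<le> 3" "i \<le> 3" "j \<le> 3" "h > i + j \<or> i > h + j \<or> j > h + i"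
  shows "p h i j = 0"
proof (rule ccontr)
  assume "p h i j \<noteq> 0"
  moreover obtain u v where uv: "u \<in> V" "v \<in> V" "D u v = h" using ex_dist[OF assms(1)] .
  ultimately obtain x where x: "x \<in> V" "D u x = i" "D v x = j" using ex_common assms by metis
  show False
    using D_triangle[of u x v] D_triangle[of u v x] D_triangle[of v u x] uv x assms(4)
      D_commute[of x v] D_commute[of v u] by linarith
qed

text \<open>The sphere of radius \<open>i\<close> about \<open>u\<close> is sorted by distance to
  \<open>v\<close>; its size is the valency \<open>p 0 i i\<close>.\<close>

lemma p_row_sum:
  assumes "h \<le> 3" "i \<le> 3"
  shows "(\<Sum>j\<le>3. p h i j) = p 0 i i"
proof -
  obtain u v where uv: "u \<in> V" "v \<in> V" "D u v = h" using ex_dist[OF assms(1)] .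
  let ?F = "\<lambda>i' j. if i' = i then 1 else 0 :: int"
  have "(\<Sum>i'\<le>3. \<Sum>j\<le>3. ?F i' j * int (p h i' j)) = (\<Sum>i'\<le>3. \<Sum>j\<le>3. ?F i' j * int (p 0 i' j))"
    using sum_pair[of u v ?F] sum_pair[of u u ?F] uv D_eq_0[of u u] by simp
  moreover have "(\<Sum>i'\<le>3. \<Sum>j\<le>3. ?F i' j * int (p h i' j)) = (\<Sum>j\<le>3. int (p h i j))" for h
  proof -
    have "(\<Sum>i'\<le>3. \<Sum>j\<le>3. ?F i' j * int (p h i' j)) =
        (\<Sum>i'\<le>3. if i' = i then \<Sum>j\<le>3. int (p h i' j) else 0)"
      by (intro sum.cong) auto
    then show ?thesis using assms by simp
  qed
  ultimately have "(\<Sum>j\<le>3. int (p h i j)) = (\<Sum>j\<le>3. int (p 0 i j))" by simp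
  also have "\<dots> = (\<Sum>j\<le>3. if j = i then int (p 0 i i) else 0)"
    using assms by (intro sum.cong refl) (auto intro!: p_eq_0)
  finally have "int (\<Sum>j\<le>3. p h i j) = int (p 0 i i)" using assms by simp
  then show ?thesis by (simp only: of_nat_eq_iff)
qed

text \<open>Around a fixed \<open>u\<close>, count in two ways the pairs at distance
  \<open>i\<close> with one vertex in the sphere of radius \<open>h\<close> and the other in that of
  radius \<open>j\<close>.\<close>

lemma p_double_count:
  assumes "h \<le> 3" "i \<le> 3" "j \<le> 3"
  shows "p 0 h h * p h j i = p 0 j j * p j h i"
proof -
  obtain u where u: "u \<in> V" using D_3 by blast
  let ?L = "\<lambda>h. {x \<in> V. D u x = h}"
  have L: "card (?L h) = p 0 h h" if "h \<le> 3" for h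
    using card_p[of u u h h] u D_eq_0[of u u] that by simp
  have n: "card {y \<in> ?L j. D x y = i} = p h j i" if "x \<in> ?L h" "h \<le> 3" "j \<le> 3" for x h j
    using card_p[of u x j i] u that assms by (simp add: conj_assoc)
  have "(\<Sum>x\<in>?L h. card {y \<in> ?L j. D x y = i}) = (\<Sum>y\<in>?L j. card {x \<in> ?L h. D x y = i})"
    using fin by (intro sum_multicount_gen) auto
  moreover have "{x \<in> ?L h. D x y = i} = {x \<in> ?L h. D y x = i}" for y
    using D_commute[of _ y] by simp
  ultimately show ?thesis
    using n assms by (simp add: L)
qed

lemma p_1:
  shows "p 0 1 0 = 0" "p 0 1 2 = 0" "p 0 1 3 = 0"
    and "p 1 1 1 = 6" "p 1 1 3 = 0"
    and "p 2 1 0 = 0" "p 2 1 2 = 103"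
    and "p 3 1 0 = 0" "p 3 1 1 = 0" "p 3 1 3 = 15"
proof -
  show z: "p 0 1 0 = 0" "p 0 1 2 = 0" "p 0 1 3 = 0" "p 1 1 3 = 0" "p 2 1 0 = 0"
    "p 3 1 0 = 0" "p 3 1 1 = 0"
    by (auto intro: p_eq_0)
  show "p 1 1 1 = 6" "p 2 1 2 = 103" "p 3 1 3 = 15"
    using p_row_sum[of 1 1] p_row_sum[of 2 1] p_row_sum[of 3 1] b0 b1 b2 c1 c2 c3
    by (simp_all add: sum_atMost_3 z del: One_nat_def)
qed

lemmas p_neighbours = b0 b1 b2 c1 c2 c3 p_1

text \<open>Double counting gives k_2 = k_1 b_1 / c_2 and k_3 = k_2 b_2 / c_3.\<close>

lemma valencies: "p 0 0 0 = 1" "p 0 2 2 = 1080" "p 0 3 3 = 144"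
proof -
  obtain u where u: "u \<in> V" using D_3 by blast
  have "{x \<in> V. D u x = 0 \<and> D u x = 0} = {u}" using u D_eq_0 by auto
  then show "p 0 0 0 = 1" using card_p[of u u 0 0] u D_eq_0[of u u] by simp
  show k2: "p 0 2 2 = 1080"
    using p_double_count[of 1 1 2] p_commute[of 1 2 1] b0 b1 c2 by simp
  show "p 0 3 3 = 144"
    using p_double_count[of 2 1 3] p_commute[of 2 3 1] p_commute[of 3 2 1] b2 c3 k2 by simp
qed

lemma p_0_off_diagonal:
  "p 0 0 1 = 0" "p 0 0 2 = 0" "p 0 0 3 = 0" "p 0 2 0 = 0" "p 0 2 1 = 0" "p 0 2 3 = 0"
  "p 0 3 0 = 0" "p 0 3 1 = 0" "p 0 3 2 = 0"
  by (auto intro: p_eq_0)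

lemma p_adjacent:
  "p 1 2 1 = 128" "p 1 2 2 = 824" "p 1 2 3 = 128" "p 1 3 2 = 128" "p 1 3 3 = 16"
proof -
  show 21: "p 1 2 1 = 128" using p_commute[of 1 2 1] b1 by simp
  \<comment> \<open>Double counting again: 135 * 128 = 1080 * 16.\<close>
  show 23: "p 1 2 3 = 128"
    using p_double_count[of 1 3 2] b0 b2 valencies by simp
  show 32: "p 1 3 2 = 128" using p_commute[of 1 3 2] 23 by simp
  have "p 1 2 0 = 0" "p 1 3 0 = 0" "p 1 3 1 = 0"
    by (auto intro: p_eq_0)
  then show "p 1 2 2 = 824" "p 1 3 3 = 16"
    using p_row_sum[of 1 2] p_row_sum[of 1 3] 21 23 32 valencies
    by (simp_all add: sum_atMost_3 del: One_nat_def)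
qed

section \<open>The idempotent of the eigenvalue -25\<close>

definition phi :: "nat \<Rightarrow> int" where
  "phi i = [27, -5, 1, -3] ! i"

lemma phi_simps: "phi 0 = 27" "phi 1 = -5" "phi 2 = 1" "phi 3 = -3"
  by (simp_all add: phi_def numeral_eq_Suc)

text \<open>The adjacency operator acts on functions of the distance from \<open>u\<close> through
  the tridiagonal intersection matrix.\<close>

lemma sum_neighbours:
  fixes f :: "nat \<Rightarrow> int"
  assumes "u \<in> V" "v \<in> V"
  shows "(\<Sum>x | x \<in> V \<and> D v x = 1. f (D u x)) = (\<Sum>j\<le>3. f j * int (p (D u v) 1 j))"
proof -
  have "(\<Sum>x | x \<in> V \<and> D v x = 1. f (D u x)) = (\<Sum>x\<in>V. if D v x = 1 then f (D u x) else 0)"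
    using fin by (simp add: sum.inter_filter)
  also have "\<dots> = (\<Sum>i\<le>3. \<Sum>j\<le>3. (if i = 1 then f j else 0) * int (p (D u v) i j))"
    using sum_pair[of v u "\<lambda>i j. if i = 1 then f j else 0"] assms D_commute[of v u] by simp
  also have "\<dots> = (\<Sum>i\<le>3. if i = 1 then \<Sum>j\<le>3. f j * int (p (D u v) i j) else 0)"
    by (intro sum.cong) auto
  finally show ?thesis by simp
qed

lemma phi_eigen:
  assumes "u \<in> V" "v \<in> V"
  shows "(\<Sum>x | x \<in> V \<and> D v x = 1. phi (D u x)) = -25 * phi (D u v)"
proof -
  consider "D u v = 0" | "D u v = 1" | "D u v = 2" | "D u v = 3"
    using D_le[OF assms] by linarith
  then show ?thesis
    by cases (simp_all add: sum_neighbours[OF assms] sum_atMost_3 phi_simps p_neighbours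
        del: One_nat_def)
qed

text \<open>
  The square of the kernel is again a function of the distance and an eigenvector for $-25$;
  the three-term recurrence leaves only the multiples of \<open>phi\<close>.
\<close>

lemma phi_convolution:
  assumes "u \<in> V" "v \<in> V"
  shows "(\<Sum>x\<in>V. phi (D u x) * phi (D v x)) = 240 * phi (D u v)"
proof -
  define g where "g h = (\<Sum>i\<le>3. \<Sum>j\<le>3. phi i * phi j * int (p h i j))" for h
  have g: "(\<Sum>x\<in>V. phi (D u x) * phi (D v x)) = g (D u v)" if "u \<in> V" "v \<in> V" for u v
    unfolding g_def by (rule sum_pair[OF that])
  \<comment> \<open>Associativity: applying adjacency to the squared kernel acts on its second
    factor, where \<open>phi_eigen\<close> applies.\<close>
  have eig: "(\<Sum>j\<le>3. g j * int (p h 1 j)) = -25 * g h" if h: "h \<le> 3" for h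
  proof -
    obtain u v where uv: "u \<in> V" "v \<in> V" "D u v = h" using ex_dist[OF h] .
    have "(\<Sum>j\<le>3. g j * int (p h 1 j)) = (\<Sum>y | y \<in> V \<and> D v y = 1. g (D u y))"
      using sum_neighbours[of u v g] uv by simp
    also have "\<dots> = (\<Sum>y | y \<in> V \<and> D v y = 1. \<Sum>x\<in>V. phi (D u x) * phi (D x y))"
    proof (intro sum.cong refl)
      fix y assume "y \<in> {y. y \<in> V \<and> D v y = 1}"
      then show "g (D u y) = (\<Sum>x\<in>V. phi (D u x) * phi (D x y))"
        using g[of u y] uv D_commute[of _ y] by simp
    qed
    also have "\<dots> = (\<Sum>x\<in>V. phi (D u x) * (\<Sum>y | y \<in> V \<and> D v y = 1. phi (D x y)))"
      by (subst sum.swap) (simp add: sum_distrib_left)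
    also have "\<dots> = (\<Sum>x\<in>V. -25 * (phi (D u x) * phi (D v x)))"
      using uv D_commute[of _ v] by (intro sum.cong) (simp_all add: phi_eigen del: One_nat_def)
    also have "\<dots> = -25 * g h"
      using uv g[of u v] by (simp only: sum_distrib_left[symmetric])
    finally show ?thesis .
  qed
  \<comment> \<open>27^2 + 135 * 5^2 + 1080 + 144 * 3^2 = 6480 = 240 * 27, which fixes the factor
    240.\<close>
  have "g 0 = 6480"
    by (simp add: g_def sum_atMost_3 phi_simps p_neighbours valencies p_0_off_diagonal
        del: One_nat_def)
  \<comment> \<open>As b_0, b_1, b_2 are nonzero, these rows yield \<open>g 1\<close>,
    \<open>g 2\<close>, \<open>g 3\<close> successively from \<open>g 0\<close>.\<close>
  moreover have "135 * g 1 = -25 * g 0" "g 0 + 6 * g 1 + 128 * g 2 = -25 * g 1"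
    "16 * g 1 + 103 * g 2 + 16 * g 3 = -25 * g 2"
    using eig[of 0] eig[of 1] eig[of 2]
    by (simp_all add: sum_atMost_3 p_neighbours del: One_nat_def)
  ultimately have g_phi: "g 0 = 240 * phi 0" "g 1 = 240 * phi 1" "g 2 = 240 * phi 2" "g 3 = 240 * phi 3"
    unfolding phi_simps by linarith+
  consider "D u v = 0" | "D u v = 1" | "D u v = 2" | "D u v = 3"
    using D_le[OF assms] by linarith
  then have "g (D u v) = 240 * phi (D u v)"
    by cases (simp_all only: g_phi)
  then show ?thesis using g assms by simp
qed

lemma phi_triple_sum:
  assumes "u \<in> V" "v \<in> V" "w \<in> V"
  shows "(\<Sum>x\<in>V. phi (D u x) * phi (D v x) * phi (D w x)) = 0"
proof (rule triple_kernel_sum_eq_0[where c = 240 and K = "\<lambda>x y. phi (D x y)", OF fin _ _ assms])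
  show "(\<Sum>u\<in>V. phi (D u x) * phi (D u y)) = 240 * phi (D x y)" if "x \<in> V" "y \<in> V" for x y
    using phi_convolution[OF that] by (simp add: D_commute)
  \<comment> \<open>The vanishing Krein parameter: 27^3 - 135 * 5^3 + 1080 - 144 * 3^3 = 0.\<close>
  have "(\<Sum>y\<in>V. phi (D x y) ^ 3) = 0" if "x \<in> V" for x
    using sum_pair[of x x "\<lambda>i j. phi i ^ 3"] that D_eq_0[of x x]
    by (simp add: sum_atMost_3 phi_simps p_neighbours valencies p_0_off_diagonal
        del: One_nat_def)
  then show "(\<Sum>x\<in>V. \<Sum>y\<in>V. phi (D x y) ^ 3) = 0" by simp
qed

section \<open>Triple intersection numbers of a triangle\<close>

lemma no_triangle:
  assumes V: "u \<in> V" "v \<in> V" "w \<in> V"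
    and adj: "D u v = 1" "D u w = 1" "D v w = 1"
  shows False
proof -
  define N where "N r s t = card {x \<in> V. D u x = r \<and> D v x = s \<and> D w x = t}" for r s t
  note D_le' = D_le[OF V(1)] D_le[OF V(2)] D_le[OF V(3)]
  have empty: "N r s t = 0"
    if "\<And>x. x \<in> V \<Longrightarrow> D u x = r \<Longrightarrow> D v x = s \<Longrightarrow> D w x = t \<Longrightarrow> False" for r s t
  proof -
    have "{x \<in> V. D u x = r \<and> D v x = s \<and> D w x = t} = {}" using that by blast
    then show ?thesis by (simp only: N_def card.empty)
  qed
  \<comment> \<open>Distances from \<open>x\<close> to adjacent vertices differ by at most 1, so no
    nonzero \<open>N r s t\<close> mixes 1 with 3.\<close>
  have close: "D u x \<le> D v x + 1" "D v x \<le> D u x + 1" "D u x \<le> D w x + 1"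
    "D w x \<le> D u x + 1" "D v x \<le> D w x + 1" "D w x \<le> D v x + 1" if "x \<in> V" for x
    using D_triangle[of u v x] D_triangle[of v u x] D_triangle[of u w x] D_triangle[of w u x]
      D_triangle[of v w x] D_triangle[of w v x] V that adj
      D_commute[of v u] D_commute[of w u] D_commute[of w v] by linarith+
  have far: "N r s t = 0"
    if "r > s + 1 \<or> s > r + 1 \<or> r > t + 1 \<or> t > r + 1 \<or> s > t + 1 \<or> t > s + 1" for r s t
    using that close by (intro empty) (elim disjE; fastforce)
  have ends: "N 0 s t = 0" if "s \<noteq> 1 \<or> t \<noteq> 1" for s t
    using that D_eq_0[of u] V adj D_commute[of v u] D_commute[of w u] by (intro empty) auto
  have ends': "N r 0 t = 0" if "r \<noteq> 1 \<or> t \<noteq> 1" for r t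
    using that D_eq_0[of v] V adj D_commute[of w v] by (intro empty) auto
  have ends'': "N r s 0 = 0" if "r \<noteq> 1 \<or> s \<noteq> 1" for r s
    using that D_eq_0[of w] V adj by (intro empty) auto
  note zero = far ends ends' ends''
  have self: "N 0 1 1 = 1" "N 1 0 1 = 1" "N 1 1 0 = 1"
  proof -
    have "{x \<in> V. D u x = 0 \<and> D v x = 1 \<and> D w x = 1} = {u}"
      "{x \<in> V. D u x = 1 \<and> D v x = 0 \<and> D w x = 1} = {v}"
      "{x \<in> V. D u x = 1 \<and> D v x = 1 \<and> D w x = 0} = {w}"
      using V adj D_eq_0 D_commute[of v u] D_commute[of w u] D_commute[of w v] by auto
    then show "N 0 1 1 = 1" "N 1 0 1 = 1" "N 1 1 0 = 1" by (simp_all add: N_def)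
  qed
  have split: "card {x \<in> V. P x} = (\<Sum>t\<le>3. card {x \<in> V. P x \<and> D z x = t})" if "z \<in> V" for P z
    using sum_by_value[of "{x \<in> V. P x}" "{..3}" "D z" "\<lambda>_. 1"] fin D_le[OF that]
    by (auto simp: image_subset_iff conj_assoc simp flip: of_nat_sum)
  \<comment> \<open>Marginals: summing out the distance to one vertex leaves the intersection number
    of the other two, which are adjacent.\<close>
  have m3: "N r s 0 + N r s 1 + N r s 2 + N r s 3 = p 1 r s" if "r \<le> 3" "s \<le> 3" for r s
    using split[OF V(3), of "\<lambda>x. D u x = r \<and> D v x = s"] card_p[of u v r s] V adj that
    by (simp add: sum_atMost_3 N_def conj_ac)
  have m2: "N r 0 t + N r 1 t + N r 2 t + N r 3 t = p 1 r t" if "r \<le> 3" "t \<le> 3" for r t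
    using split[OF V(2), of "\<lambda>x. D u x = r \<and> D w x = t"] card_p[of u w r t] V adj that
    by (simp add: sum_atMost_3 N_def conj_ac)
  have m1: "N 0 s t + N 1 s t + N 2 s t + N 3 s t = p 1 s t" if "s \<le> 3" "t \<le> 3" for s t
    using split[OF V(1), of "\<lambda>x. D v x = s \<and> D w x = t"] card_p[of v w s t] V adj that
    by (simp add: sum_atMost_3 N_def conj_ac)
  have "0 = (\<Sum>a\<in>{..3} \<times> {..3} \<times> {..3}. phi (fst a) * phi (fst (snd a)) * phi (snd (snd a)) *
      int (card {x \<in> V. (D u x, D v x, D w x) = a}))"
    using sum_by_value[of V "{..3} \<times> {..3} \<times> {..3}" "\<lambda>x. (D u x, D v x, D w x)"
        "\<lambda>a. phi (fst a) * phi (fst (snd a)) * phi (snd (snd a))"]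
      fin D_le' phi_triple_sum[OF V] by (simp add: image_subset_iff)
  also have "\<dots> = (\<Sum>r\<le>3. \<Sum>s\<le>3. \<Sum>t\<le>3. phi r * phi s * phi t * int (N r s t))"
    by (simp add: sum.cartesian_product' N_def)
  \<comment> \<open>The vertices \<open>u\<close>, \<open>v\<close>, \<open>w\<close> themselves
    contribute 3 * 27 * (-5)^2 = 2025.\<close>
  also have "\<dots> = 2025 - 125 * int (N 1 1 1) + 25 * int (N 1 1 2 + N 1 2 1 + N 2 1 1)
      - 5 * int (N 1 2 2 + N 2 1 2 + N 2 2 1) + int (N 2 2 2)
      - 3 * int (N 2 2 3 + N 2 3 2 + N 3 2 2) + 9 * int (N 2 3 3 + N 3 2 3 + N 3 3 2)
      - 27 * int (N 3 3 3)"
    by (simp add: sum_atMost_3 phi_simps zero self del: One_nat_def)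
  finally have krein: "\<dots> = 0" by simp
  \<comment> \<open>Let \<alpha> = \<open>N 1 1 1\<close> and \<beta> = \<open>N 3 3 3\<close>. Up
    to permuting indices, the marginals give \<open>N 1 1 2\<close> = 5 - \<alpha>,
    \<open>N 1 2 2\<close> = 123 + \<alpha>, \<open>N 2 3 3\<close> = 16 - \<beta>,
    \<open>N 2 2 3\<close> = 112 + \<beta> and \<open>N 2 2 2\<close> = 589 - \<alpha> - \<beta>.
    Then \<open>krein\<close> reads 216 \<alpha> + 64 \<beta> = 568; divide by 8.\<close>
  have "27 * N 1 1 1 + 8 * N 3 3 3 = 71"
    using krein
      m3[of 1 1] m3[of 1 2] m3[of 2 1] m3[of 2 2] m3[of 2 3] m3[of 3 2] m3[of 3 3]
      m2[of 1 1] m2[of 1 2] m2[of 2 1] m2[of 2 3] m2[of 3 2] m2[of 3 3]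
      m1[of 1 1] m1[of 1 2] m1[of 2 1] m1[of 2 3] m1[of 3 2] m1[of 3 3]
    by (simp add: zero self p_neighbours p_adjacent del: One_nat_def)
  \<comment> \<open>Only 0, 1, 2 are possible for \<open>N 1 1 1\<close>, and 71, 44, 17 are not
    divisible by 8.\<close>
  then show False by presburger
qed

lemma inconsistent: False
proof -
  obtain u v where uv: "u \<in> V" "v \<in> V" "D u v = 1" using ex_dist[of 1] by auto
  obtain w where "w \<in> V" "D u w = 1" "D v w = 1"
    using ex_common[of u v 1 1] uv p_1 by auto
  then show False using no_triangle uv by blast
qed

end

section \<open>Transfer to distance-regular graphs\<close>

theorem theorem4:
  shows "\<not> (\<exists>G :: 'a pair_pre_digraph.
           distance_regular G \<and> has_intersection_array G [135, 128, 16] [1, 16, 120])"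
proof
  assume "\<exists>G :: 'a pair_pre_digraph.
           distance_regular G \<and> has_intersection_array G [135, 128, 16] [1, 16, 120]"
  then obtain G :: "'a pair_pre_digraph" and d p where
    reg: "distance_regular G"
    and dp: "has_diameter G d" "has_intersection_numbers G d p" "length [135, 128, 16 :: nat] = d"
      "\<forall>i<d. [135, 128, 16] ! i = p i 1 (i + 1) \<and> [1, 16, 120] ! i = p (i + 1) 1 i"
    unfolding has_intersection_array_def by blast
  have "d = 3" using dp(3) by simp
  note diam = dp(1)[unfolded this] and num = dp(2)[unfolded this] and arr = dp(4)[unfolded this]
  from reg have bidir: "pair_bidirected_digraph G"
    and conn: "Digraph_Component.connected (with_proj G)"
    by (simp_all add: distance_regular_def)
  interpret pair_bidirected_digraph G by (rule bidir)
  \<comment> \<open>\<open>connected\<close> ignores arc directions; symmetry of the arcs turns it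
    into reachability, so that \<open>graph_dist\<close> is the length of an actual walk.\<close>
  have reach: "u \<rightarrow>\<^sup>*\<^bsub>with_proj G\<^esub> v" if "u \<in> pverts G" "v \<in> pverts G" for u v
    using symmetric_connected_imp_strongly_connected[OF sym_arcs conn] that
    by (auto elim: strongly_connectedE)
  have le: "graph_dist G u v \<le> 3" if "u \<in> pverts G" "v \<in> pverts G" for u v
    using diam that by (simp add: has_diameter_def)
  have cnt: "finite {x \<in> pverts G. graph_dist G u x = i \<and> graph_dist G v x = j} \<and>
      card {x \<in> pverts G. graph_dist G u x = i \<and> graph_dist G v x = j} = p (graph_dist G u v) i j"
    if "u \<in> pverts G" "v \<in> pverts G" "i \<le> 3" "j \<le> 3" for u v i j
    using num that le[OF that(1,2)] by (simp add: has_intersection_numbers_def)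
  interpret drg_135 "pverts G" "graph_dist G" p
  proof
    obtain u where u: "u \<in> pverts G" using diam by (auto simp: has_diameter_def)
    \<comment> \<open>The four spheres about \<open>u\<close> cover the graph; each is finite by the
      counting condition for the pair \<open>u\<close>, \<open>u\<close>.\<close>
    have "pverts G = (\<Union>i\<le>3. {x \<in> pverts G. graph_dist G u x = i \<and> graph_dist G u x = i})"
      using le[OF u] by auto
    also have "finite \<dots>" using cnt[OF u u] by blast
    finally show "finite (pverts G)" .
    show "\<exists>u\<in>pverts G. \<exists>v\<in>pverts G. graph_dist G u v = 3"
      using diam by (simp add: has_diameter_def)
    show "p 0 1 1 = 135" "p 1 1 2 = 128" "p 2 1 3 = 16" "p 1 1 0 = 1" "p 2 1 1 = 16" "p 3 1 2 = 120"
      using arr[rule_format, of 0] arr[rule_format, of 1] arr[rule_format, of 2]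
      by (simp_all add: numeral_eq_Suc)
  qed (use reach le cnt graph_dist_commute graph_dist_eq_0_iff graph_dist_triangle in auto)
  show False by (rule inconsistent)
qed

end
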